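(* Let $(X,r)$ and $(Y,s)$ be non-degenerate and involutive set-theoretic solutions of the Yang-Baxter equation, with $|X|=n$ and $|Y|=m$. Let $c:V\otimes V\rightarrow V\otimes V$ and $d:V'\otimes V'\rightarrow V'\otimes V'$ be the linearisations of $r$ and $s$ respectively, and denote also by $c$ and $d$ their representing matrices with respect to the lexicographically ordered bases. Partition $c$ into $n^2$ square blocks $B_{ij}$ of order $n$ ($1\le i,j\le n$), and partition $d$ into $m^2$ square blocks $B'_{kl}$ of order $m$ ($1\le k,l\le m$). Let $c\boxtimes d$ denote the Tracy-Singh product of the matrices $c$ and $d$ with these partitions. Let $(Z,t)$, with $Z=X\times Y$, be the direct product of $(X,r)$ and $(Y,s)$, with linearisation $e:W\otimes W\rightarrow W\otimes W$. Then $c\boxtimes d$ is the representing matrix of the linear automorphism $e$ with respect to the (lexicographically ordered) basis $Z\otimes Z$ of $W\otimes W$.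
   Context: A set-theoretic solution of the Yang-Baxter equation (st-YBE) is a pair $(X,r)$ where $X$ is a non-empty set and $r:X\times X\to X\times X$, $r(x,y)=(\sigma_x(y),\gamma_y(x))$, is a bijective map satisfying $r^{12}r^{23}r^{12}=r^{23}r^{12}r^{23}$ on $X^3$, where $r^{12}=r\times \mathrm{Id}_X$ and $r^{23}=\mathrm{Id}_X\times r$. It is non-degenerate if $\sigma_x$ and $\gamma_x$ are bijections of $X$ for every $x\in X$, and involutive if $r^2=\mathrm{Id}_{X\times X}$. Write $X=\{x_1,\dots,x_n\}$, $Y=\{y_1,\dots,y_m\}$, $r(x_i,x_j)=(x_{\sigma_i(j)},x_{\gamma_j(i)})$ and $s(y_k,y_l)=(y_{\alpha_k(l)},y_{\beta_l(k)})$, so that $\sigma_i,\gamma_i$ are regarded as permutations of $\{1,\dots,n\}$ and $\alpha_k,\beta_k$ as permutations of $\{1,\dots,m\}$. Direct product: $Z=X\times Y$ and $t:Z^2\to Z^2$ is defined by $t((x_i,y_k),(x_j,y_l))=((x_{\sigma_i(j)},y_{\alpha_k(l)}),(x_{\gamma_j(i)},y_{\beta_l(k)}))$; $(Z,t)$ is again a non-degenerate involutive st-YBE. Linearisation: for $(X,r)$ with $X=\{x_1,\dots,x_n\}$, let $V$ be the real vector space with basis $\{e_1,\dots,e_n\}$ in bijection with $X$; the linearisation of $r$ is the linear operator $c:V\otimes V\to V\otimes V$ induced by $r$, i.e. $c(e_i\otimes e_j)=e_{\sigma_i(j)}\otimes e_{\gamma_j(i)}$. Similarly for $(Y,s)$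 (with space $V'$) and $(Z,t)$ (with space $W$ having basis in bijection with $Z$). Ordering and matrix conventions: the basis $\{e_i\otimes e_j\}$ of $V\otimes V$ is ordered lexicographically, and similarly for $V'\otimes V'$. The elements of $Z$ are ordered lexicographically, $(x_1,y_1),(x_1,y_2),\dots,(x_1,y_m),(x_2,y_1),\dots,(x_n,y_m)$, and the basis $Z\otimes Z$ of $W\otimes W$ consists of the tensors $z\otimes z'$, $z,z'\in Z$ (identified with the corresponding basis vectors of $W$), ordered lexicographically with respect to this order on $Z$. Columns of a representing matrix are the coordinates of the images of the basis vectors. Tracy-Singh product: for a matrix $A$ partitioned into blocks $A_{ij}$ and a matrix $B$ partitioned into blocks $B_{kl}$, $A\boxtimes B=((A_{ij}\otimes B_{kl})_{kl})_{ij}$, where $\otimes$ is the Kronecker product $A\otimes B=(a_{ij}B)_{ij}$; that is, $A\boxtimes B$ is the block matrix whose $(i,j)$ outer block is itself the block matrix whose $(k,l)$ block is $A_{ij}\otimes B_{kl}$. *)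

theory Defs
  imports "HOL-Analysis.Linear_Algebra" "Jordan_Normal_Form.Matrix"
begin

section \<open>Set-theoretic solutions of the Yang-Baxter equation\<close>

definition r12 :: "('a \<times> 'a \<Rightarrow> 'a \<times> 'a) \<Rightarrow> 'a \<times> 'a \<times> 'a \<Rightarrow> 'a \<times> 'a \<times> 'a" where
  "r12 r = (\<lambda>(x, y, z). (fst (r (x, y)), snd (r (x, y)), z))"

definition r23 :: "('a \<times> 'a \<Rightarrow> 'a \<times> 'a) \<Rightarrow> 'a \<times> 'a \<times> 'a \<Rightarrow> 'a \<times> 'a \<times> 'a" where
  "r23 r = (\<lambda>(x, y, z). (x, r (y, z)))"

definition st_YBE :: "'a set \<Rightarrow> ('a \<times> 'a \<Rightarrow> 'a \<times> 'a) \<Rightarrow> bool" where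
  "st_YBE X r \<longleftrightarrow> X \<noteq> {} \<and> bij_betw r (X \<times> X) (X \<times> X) \<and>
     (\<forall>p \<in> X \<times> X \<times> X. r12 r (r23 r (r12 r p)) = r23 r (r12 r (r23 r p)))"

text \<open>With these, \<open>r (x, y) = (\<sigma> r x y, \<gamma> r y x)\<close>; note the order of the arguments of \<open>\<gamma>\<close>.\<close>

definition \<sigma> :: "('a \<times> 'a \<Rightarrow> 'a \<times> 'a) \<Rightarrow> 'a \<Rightarrow> 'a \<Rightarrow> 'a" where
  "\<sigma> r x y = fst (r (x, y))"

definition \<gamma> :: "('a \<times> 'a \<Rightarrow> 'a \<times> 'a) \<Rightarrow> 'a \<Rightarrow> 'a \<Rightarrow> 'a" where
  "\<gamma> r y x = snd (r (x, y))"

definition non_degenerate :: "'a set \<Rightarrow> ('a \<times> 'a \<Rightarrow> 'a \<times> 'a) \<Rightarrow> bool" where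
  "non_degenerate X r \<longleftrightarrow> (\<forall>x \<in> X. bij_betw (\<sigma> r x) X X \<and> bij_betw (\<gamma> r x) X X)"

definition involutive :: "'a set \<Rightarrow> ('a \<times> 'a \<Rightarrow> 'a \<times> 'a) \<Rightarrow> bool" where
  "involutive X r \<longleftrightarrow> (\<forall>p \<in> X \<times> X. r (r p) = p)"

definition direct_product ::
  "('a \<times> 'a \<Rightarrow> 'a \<times> 'a) \<Rightarrow> ('b \<times> 'b \<Rightarrow> 'b \<times> 'b) \<Rightarrow>
   ('a \<times> 'b) \<times> ('a \<times> 'b) \<Rightarrow> ('a \<times> 'b) \<times> ('a \<times> 'b)" where
  "direct_product r s =
     (\<lambda>((x, u), (y, v)). ((\<sigma> r x y, \<sigma> s u v), (\<gamma> r y x, \<gamma> s v u)))"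

section \<open>Tensor products and linearisations\<close>

definition basis_indexed_by :: "'a set \<Rightarrow> ('a \<Rightarrow> 'v::real_vector) \<Rightarrow> bool" where
  "basis_indexed_by X b \<longleftrightarrow> inj_on b X \<and> independent (b ` X) \<and> span (b ` X) = UNIV"

text \<open>
  The universal property of \<open>tens :: V \<times> V' \<rightarrow> V \<otimes> V'\<close>. A definition cannot quantify over the
  types of all target spaces; the scalar target suffices, since a linear map is an isomorphism
  as soon as its transpose is one. Lemma \<open>tensor_product_universal\<close> below gives
  the property for an arbitrary target.
\<close>

definition tensor_product ::
  "('v::real_vector \<Rightarrow> 'w::real_vector \<Rightarrow> 't::real_vector) \<Rightarrow> bool" where
  "tensor_product tens \<longleftrightarrow> bilinear tens \<and>
     (\<forall>f :: 'v \<Rightarrow> 'w \<Rightarrow> real. bilinear f \<longrightarrow>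
        (\<exists>!g. linear g \<and> (\<forall>u v. g (tens u v) = f u v)))"

definition is_linearisation ::
  "'a set \<Rightarrow> ('a \<times> 'a \<Rightarrow> 'a \<times> 'a) \<Rightarrow> ('a \<Rightarrow> 'v::real_vector) \<Rightarrow>
   ('v \<Rightarrow> 'v \<Rightarrow> 't::real_vector) \<Rightarrow> ('t \<Rightarrow> 't) \<Rightarrow> bool" where
  "is_linearisation X r b tens c \<longleftrightarrow> linear c \<and>
     (\<forall>x \<in> X. \<forall>y \<in> X. c (tens (b x) (b y)) = tens (b (\<sigma> r x y)) (b (\<gamma> r y x)))"

section \<open>Representing matrices\<close>

text \<open>\<open>List.product\<close> enumerates pairs lexicographically.\<close>

definition lex_tensor_basis ::
  "('a \<Rightarrow> 'v::real_vector) \<Rightarrow> ('v \<Rightarrow> 'v \<Rightarrow> 't::real_vector) \<Rightarrow> 'a list \<Rightarrow> 't list" where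
  "lex_tensor_basis b tens xs = map (\<lambda>(x, y). tens (b x) (b y)) (List.product xs xs)"

definition representing_mat :: "'t::real_vector list \<Rightarrow> ('t \<Rightarrow> 't) \<Rightarrow> real mat" where
  "representing_mat bs f =
     mat (length bs) (length bs) (\<lambda>(i, j). representation (set bs) (f (bs ! j)) (bs ! i))"

section \<open>Block matrices, Kronecker product and Tracy-Singh product\<close>

text \<open>
  All matrix, block and block-entry indices start at 0.
  \<open>block p q A i j\<close> is the block in position (i, j) of \<open>A\<close>, when \<open>A\<close> is partitioned into
  blocks of size p by q; \<open>from_blocks R C p q F\<close> is the matrix consisting of R by C blocks
  \<open>F i j\<close>, each of size p by q.
\<close>

definition block :: "nat \<Rightarrow> nat \<Rightarrow> 'k mat \<Rightarrow> nat \<Rightarrow> nat \<Rightarrow> 'k mat" where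
  "block p q A i j = mat p q (\<lambda>(a, b). A $$ (i * p + a, j * q + b))"

definition from_blocks ::
  "nat \<Rightarrow> nat \<Rightarrow> nat \<Rightarrow> nat \<Rightarrow> (nat \<Rightarrow> nat \<Rightarrow> 'k mat) \<Rightarrow> 'k mat" where
  "from_blocks R C p q F =
     mat (R * p) (C * q) (\<lambda>(i, j). F (i div p) (j div q) $$ (i mod p, j mod q))"

definition kronecker :: "'k::times mat \<Rightarrow> 'k mat \<Rightarrow> 'k mat" where
  "kronecker A B =
     from_blocks (dim_row A) (dim_col A) (dim_row B) (dim_col B) (\<lambda>i j. A $$ (i, j) \<cdot>\<^sub>m B)"

text \<open>
  Tracy-Singh product of \<open>A\<close>, partitioned into blocks of size p by q, and \<open>B\<close>, partitioned
  into blocks of size p' by q'. Only partitions into blocks of equal size are covered.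
\<close>

definition tracy_singh ::
  "nat \<Rightarrow> nat \<Rightarrow> 'k::times mat \<Rightarrow> nat \<Rightarrow> nat \<Rightarrow> 'k mat \<Rightarrow> 'k mat" where
  "tracy_singh p q A p' q' B =
     (let R = dim_row A div p; C = dim_col A div q;
          R' = dim_row B div p'; C' = dim_col B div q'
      in from_blocks R C (R' * (p * p')) (C' * (q * q'))
           (\<lambda>i j. from_blocks R' C' (p * p') (q * q')
              (\<lambda>k l. kronecker (block p q A i j) (block p' q' B k l))))"

section \<open>Adequacy of the tensor product and of linearisations\<close>

lemma ex1_linear_on_basis:
  fixes h :: "'t::real_vector \<Rightarrow> 's::real_vector"
  assumes "independent B" "span B = UNIV"
  shows "\<exists>!g. linear g \<and> (\<forall>x\<in>B. g x = h x)"
proof -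
  obtain g where g: "linear g" "\<forall>x\<in>B. g x = h x"
    using linear_independent_extend[OF assms(1)] by blast
  show ?thesis
  proof (rule ex1I[of _ g])
    fix g' assume g': "linear g' \<and> (\<forall>x\<in>B. g' x = h x)"
    show "g' = g"
    proof
      fix t
      show "g' t = g t"
        by (rule linear_eq_on_span[of g' g B t]) (use g g' assms in auto)
    qed
  qed (use g in blast)
qed

lemma bilinear_ext_basis:
  fixes f g :: "'v::real_vector \<Rightarrow> 'w::real_vector \<Rightarrow> 's::real_vector"
  assumes "bilinear f" "bilinear g" "span (b ` X) = UNIV" "span (b' ` Y) = UNIV"
    and "\<And>x y. x \<in> X \<Longrightarrow> y \<in> Y \<Longrightarrow> f (b x) (b' y) = g (b x) (b' y)"
  shows "f u v = g u v"
  by (rule bilinear_eq[of f g UNIV "b ` X" UNIV "b' ` Y"]) (use assms in auto)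

lemma bilinear_linear_compose:
  assumes "bilinear f" "linear g"
  shows "bilinear (\<lambda>u v. g (f u v))"
proof -
  have "linear (\<lambda>v. g (f u v))" for u
    using linear_compose[of "f u" g] assms by (simp add: bilinear_def o_def)
  moreover have "linear (\<lambda>u. g (f u v))" for v
    using linear_compose[of "\<lambda>u. f u v" g] assms by (simp add: bilinear_def o_def)
  ultimately show ?thesis by (simp add: bilinear_def)
qed

lemma ex_bilinear_on_basis:
  fixes h :: "'a \<Rightarrow> 'b \<Rightarrow> 's::real_vector"
    and b :: "'a \<Rightarrow> 'v::real_vector" and b' :: "'b \<Rightarrow> 'w::real_vector"
  assumes "inj_on b X" "independent (b ` X)" "inj_on b' Y" "independent (b' ` Y)"
  shows "\<exists>f. bilinear f \<and> (\<forall>x\<in>X. \<forall>y\<in>Y. f (b x) (b' y) = h x y)"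
proof -
  have "\<exists>\<phi>. linear \<phi> \<and> (\<forall>y\<in>Y. \<phi> (b' y) = h x y)" for x
    using linear_independent_extend[OF assms(4), of "\<lambda>w. h x (inv_into Y b' w)"] assms(3)
    by auto
  then obtain \<phi> where \<phi>: "\<And>x. linear (\<phi> x)" "\<And>x y. y \<in> Y \<Longrightarrow> \<phi> x (b' y) = h x y"
    by metis
  define X0 where "X0 = extend_basis (b ` X)"
  have X0: "independent X0" "span X0 = UNIV" "b ` X \<subseteq> X0"
    using assms(2) unfolding X0_def
    by (auto simp: independent_extend_basis span_extend_basis extend_basis_superset)
  have "\<exists>\<psi>. linear \<psi> \<and> (\<forall>w\<in>X0. \<psi> w = \<phi> (inv_into X b w) v)" for v
    using linear_independent_extend[OF X0(1), of "\<lambda>w. \<phi> (inv_into X b w) v"] by simp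
  then obtain \<psi> where \<psi>: "\<And>v. linear (\<psi> v)"
      "\<And>v w. w \<in> X0 \<Longrightarrow> \<psi> v w = \<phi> (inv_into X b w) v"
    by metis
  have add: "\<psi> (v + v') u = \<psi> v u + \<psi> v' u" for v v' u
    by (rule linear_eq_on_span[of "\<psi> (v + v')" "\<lambda>u. \<psi> v u + \<psi> v' u" X0])
       (use X0 \<psi> \<phi> in \<open>auto intro: linear_compose_add simp: linear_add\<close>)
  have scale: "\<psi> (k *\<^sub>R v) u = k *\<^sub>R \<psi> v u" for k v u
    by (rule linear_eq_on_span[of "\<psi> (k *\<^sub>R v)" "\<lambda>u. k *\<^sub>R \<psi> v u" X0])
       (use X0 \<psi> \<phi> in \<open>auto intro: linear_compose_scale_right simp: linear_scale\<close>)
  have "bilinear (\<lambda>u v. \<psi> v u)"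
    unfolding bilinear_def using \<psi>(1) add scale by (auto intro: linearI)
  moreover have "\<psi> (b' y) (b x) = h x y" if "x \<in> X" "y \<in> Y" for x y
    using that \<psi>(2)[of "b x" "b' y"] X0(3) \<phi>(2) assms(1) by auto
  ultimately show ?thesis by blast
qed

lemma ex1_linear_of_bilinear:
  fixes tens :: "'v::real_vector \<Rightarrow> 'w::real_vector \<Rightarrow> 't::real_vector"
    and f :: "'v \<Rightarrow> 'w \<Rightarrow> 's::real_vector"
  assumes b: "basis_indexed_by X b" and b': "basis_indexed_by Y b'"
    and bl: "bilinear tens" and t: "basis_indexed_by (X \<times> Y) (\<lambda>(x, y). tens (b x) (b' y))"
    and f: "bilinear f"
  shows "\<exists>!g. linear g \<and> (\<forall>u v. g (tens u v) = f u v)"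
proof -
  let ?t = "\<lambda>(x, y). tens (b x) (b' y)"
  note bb = b[unfolded basis_indexed_by_def] b'[unfolded basis_indexed_by_def]
  have inj: "inj_on ?t (X \<times> Y)"
    and B: "independent (?t ` (X \<times> Y))" "span (?t ` (X \<times> Y)) = UNIV"
    using t by (auto simp: basis_indexed_by_def)
  let ?h = "\<lambda>t. case inv_into (X \<times> Y) ?t t of (x, y) \<Rightarrow> f (b x) (b' y)"
  have "(\<forall>t\<in>?t ` (X \<times> Y). g t = ?h t) \<longleftrightarrow> (\<forall>u v. g (tens u v) = f u v)"
    if g: "linear g" for g
  proof
    assume L: "\<forall>t\<in>?t ` (X \<times> Y). g t = ?h t"
    have g1: "g (tens (b x) (b' y)) = f (b x) (b' y)" if "x \<in> X" "y \<in> Y" for x y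
      using L that inv_into_f_f[OF inj, of "(x, y)"] by auto
    have blg: "bilinear (\<lambda>u v. g (tens u v))"
      using bl g by (rule bilinear_linear_compose)
    show "\<forall>u v. g (tens u v) = f u v"
      using bilinear_ext_basis[OF blg f, of b X b' Y] bb g1 by blast
  next
    assume "\<forall>u v. g (tens u v) = f u v"
    then show "\<forall>t\<in>?t ` (X \<times> Y). g t = ?h t"
      using inv_into_f_f[OF inj] by auto
  qed
  then show ?thesis using ex1_linear_on_basis[OF B, of ?h] by (metis (no_types, lifting))
qed

lemma tensor_product_iff_basis:
  fixes tens :: "'v::real_vector \<Rightarrow> 'w::real_vector \<Rightarrow> 't::real_vector"
  assumes b: "basis_indexed_by X b" and b': "basis_indexed_by Y b'"
  shows "tensor_product tens \<longleftrightarrow>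
    bilinear tens \<and> basis_indexed_by (X \<times> Y) (\<lambda>(x, y). tens (b x) (b' y))"
    (is "_ \<longleftrightarrow> _ \<and> basis_indexed_by _ ?t")
proof (intro iffI conjI)
  note bb = b[unfolded basis_indexed_by_def] b'[unfolded basis_indexed_by_def]
  assume T: "tensor_product tens"
  then show bl: "bilinear tens" by (simp add: tensor_product_def)
  have dual: "\<exists>g :: 't \<Rightarrow> real. linear g \<and> (\<forall>p\<in>X \<times> Y. g (?t p) = (if p = p0 then 1 else 0))" for p0
  proof -
    obtain f :: "'v \<Rightarrow> 'w \<Rightarrow> real" where f: "bilinear f"
        "\<forall>x\<in>X. \<forall>y\<in>Y. f (b x) (b' y) = (if (x, y) = p0 then 1 else 0)"
      using ex_bilinear_on_basis[of b X b' Y "\<lambda>x y. if (x, y) = p0 then 1 else (0::real)"] bb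
      by blast
    then obtain g where "linear g" "\<forall>u v. g (tens u v) = f u v"
      using T unfolding tensor_product_def by blast
    with f show ?thesis by (intro exI[of _ g]) auto
  qed
  have inj: "inj_on ?t (X \<times> Y)"
  proof (rule inj_onI)
    fix p q assume "p \<in> X \<times> Y" "q \<in> X \<times> Y" "?t p = ?t q"
    then show "p = q" using dual[of p] by (metis zero_neq_one)
  qed
  have ind: "independent (?t ` (X \<times> Y))"
  proof
    assume "dependent (?t ` (X \<times> Y))"
    then obtain p where p: "p \<in> X \<times> Y" "?t p \<in> span (?t ` (X \<times> Y) - {?t p})"
      unfolding dependent_def by blast
    obtain g :: "'t \<Rightarrow> real" where g: "linear g"
        "\<forall>q\<in>X \<times> Y. g (?t q) = (if q = p then 1 else 0)"
      using dual[of p] by blast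
    have "g (?t p) = 0"
      by (rule linear_eq_0_on_span[of g "?t ` (X \<times> Y) - {?t p}"]) (use g p in auto)
    with g p show False by auto
  qed
  have "span (?t ` (X \<times> Y)) = UNIV"
  proof (rule ccontr)
    assume ne: "span (?t ` (X \<times> Y)) \<noteq> UNIV"
    then obtain t0 where t0: "t0 \<notin> span (?t ` (X \<times> Y))" by blast
    then have "independent (insert t0 (?t ` (X \<times> Y)))"
      using ind by (simp add: independent_insertI)
    then obtain g :: "'t \<Rightarrow> real" where g: "linear g"
        "\<forall>x\<in>insert t0 (?t ` (X \<times> Y)). g x = (if x = t0 then 1 else 0)"
      using linear_independent_extend[of _ "\<lambda>x. if x = t0 then 1 else (0::real)"] by blast
    have gz: "g (?t p) = 0" if "p \<in> X \<times> Y" for p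
      using g that t0 span_base[of "?t p" "?t ` (X \<times> Y)"] by auto
    have blz: "bilinear (\<lambda>(u::'v) (v::'w). 0::real)"
      by (auto simp: bilinear_def intro: linearI)
    have blg: "bilinear (\<lambda>u v. g (tens u v))"
      using bl g(1) by (rule bilinear_linear_compose)
    have "g (tens u v) = 0" for u v
      by (rule bilinear_ext_basis[OF blg blz, of b X b' Y]) (use bb gz in auto)
    moreover have "linear (\<lambda>t::'t. 0::real)" by (auto intro: linearI)
    ultimately have "g = (\<lambda>t. 0)"
      using T g(1) blz unfolding tensor_product_def by (metis (no_types, lifting))
    with g(2) show False by auto
  qed
  with inj ind show "basis_indexed_by (X \<times> Y) ?t"
    by (simp add: basis_indexed_by_def)
next
  assume H: "bilinear tens \<and> basis_indexed_by (X \<times> Y) ?t"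
  have "\<exists>!g. linear g \<and> (\<forall>u v. g (tens u v) = f u v)"
    if "bilinear f" for f :: "'v \<Rightarrow> 'w \<Rightarrow> real"
    by (rule ex1_linear_of_bilinear[OF b b' conjunct1[OF H] conjunct2[OF H] that])
  with H show "tensor_product tens" by (simp add: tensor_product_def)
qed

lemma ex_basis_indexed_by: "\<exists>B :: 'v::real_vector set. basis_indexed_by B id"
  by (rule exI[of _ "extend_basis {}"])
     (simp add: basis_indexed_by_def independent_extend_basis span_extend_basis independent_empty)

lemma tensor_product_universal:
  fixes tens :: "'v::real_vector \<Rightarrow> 'w::real_vector \<Rightarrow> 't::real_vector"
    and f :: "'v \<Rightarrow> 'w \<Rightarrow> 's::real_vector"
  assumes "tensor_product tens" "bilinear f"
  shows "\<exists>!g. linear g \<and> (\<forall>u v. g (tens u v) = f u v)"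
proof -
  obtain B :: "'v set" and C :: "'w set"
    where B: "basis_indexed_by B id" and C: "basis_indexed_by C id"
    using ex_basis_indexed_by by metis
  have "bilinear tens" "basis_indexed_by (B \<times> C) (\<lambda>(x, y). tens (id x) (id y))"
    using iffD1[OF tensor_product_iff_basis[OF B C] assms(1)] by simp_all
  then show ?thesis by (rule ex1_linear_of_bilinear[OF B C _ _ assms(2)])
qed

lemma ex1_linearisation:
  assumes b: "basis_indexed_by X b" and t: "tensor_product tens"
  shows "\<exists>!c. is_linearisation X r b tens c"
proof -
  let ?t = "\<lambda>(x, y). tens (b x) (b y)"
  have B: "inj_on ?t (X \<times> X)" "independent (?t ` (X \<times> X))" "span (?t ` (X \<times> X)) = UNIV"
    using tensor_product_iff_basis[OF b b, of tens] t by (auto simp: basis_indexed_by_def)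
  let ?h = "\<lambda>v. case inv_into (X \<times> X) ?t v of (x, y) \<Rightarrow> tens (b (\<sigma> r x y)) (b (\<gamma> r y x))"
  have h: "?h (tens (b x) (b y)) = tens (b (\<sigma> r x y)) (b (\<gamma> r y x))"
    if "x \<in> X" "y \<in> X" for x y
    using inv_into_f_f[OF B(1), of "(x, y)"] that by simp
  have "is_linearisation X r b tens c \<longleftrightarrow> linear c \<and> (\<forall>v\<in>?t ` (X \<times> X). c v = ?h v)" for c
    unfolding is_linearisation_def using h by auto
  then show ?thesis using ex1_linear_on_basis[OF B(2,3), of ?h] by simp
qed

end

theory Submission
  imports Defs
begin

text \<open>
  All three representing matrices are 0/1 matrices: the entry at \<open>(p, q)\<close> is 1 iff the
  \<open>q\<close>-th basis pair is mapped to the \<open>p\<close>-th one. Write an index of \<open>Z \<times> Z\<close> in mixed radix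
  as \<open>(i, k, a, b)\<close> with \<open>i, a < n\<close> and \<open>k, b < m\<close>: lexicographic order on \<open>Z \<times> Z\<close> reads it as
  \<open>((x_i, y_k), (x_a, y_b))\<close>, and the Tracy-Singh product reads it as the index \<open>(i, a)\<close> of the
  first factor and \<open>(k, b)\<close> of the second. So both sides agree entrywise. The operator is
  bijective because involutivity of the solution passes to it.
\<close>

lemma nat_mult_add_less:
  fixes a b i j :: nat
  assumes "i < a" "j < b"
  shows "i * b + j < a * b"
proof -
  have "i * b + j < Suc i * b" using assms by simp
  also have "\<dots> \<le> a * b" using assms by (intro mult_le_mono1) simp
  finally show ?thesis .
qed

lemma kronecker_index:
  assumes "i < dim_row A * dim_row B" "j < dim_col A * dim_col B"
  shows "kronecker A B $$ (i, j) =
    A $$ (i div dim_row B, j div dim_col B) * B $$ (i mod dim_row B, j mod dim_col B)"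
proof -
  have "dim_row B > 0" "dim_col B > 0" using assms by (auto intro!: gr0I)
  then show ?thesis using assms by (simp add: kronecker_def from_blocks_def)
qed

lemma tracy_singh_dim:
  assumes "A \<in> carrier_mat (R * p) (C * q)" "B \<in> carrier_mat (R' * p') (C' * q')"
    and "p > 0" "q > 0" "p' > 0" "q' > 0"
  shows "dim_row (tracy_singh p q A p' q' B) = R * (R' * (p * p'))"
    and "dim_col (tracy_singh p q A p' q' B) = C * (C' * (q * q'))"
  using assms by (auto simp: tracy_singh_def from_blocks_def Let_def)

text \<open>In mixed radix a row index is \<open>I = ((i * R' + k) * p + a) * p' + b\<close>: outer
  block \<open>i\<close>, inner block \<open>k\<close>, and row \<open>a * p' + b\<close> of the
  Kronecker product of two blocks. The Kronecker product reads row \<open>a\<close> of the block of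
  \<open>A\<close> and row \<open>b\<close> of the block of \<open>B\<close>, hence row
  \<open>i * p + a\<close> of \<open>A\<close> and row \<open>k * p' + b\<close> of
  \<open>B\<close>. Columns split in the same way.\<close>

lemma tracy_singh_index:
  fixes I J :: nat
  assumes A: "A \<in> carrier_mat (R * p) (C * q)" and B: "B \<in> carrier_mat (R' * p') (C' * q')"
    and I: "I < R * (R' * (p * p'))" and J: "J < C * (C' * (q * q'))"
  shows "tracy_singh p q A p' q' B $$ (I, J) =
     A $$ (I div (R' * (p * p')) * p + I mod (p * p') div p',
           J div (C' * (q * q')) * q + J mod (q * q') div q') *
     B $$ (I div (p * p') mod R' * p' + I mod p', J div (q * q') mod C' * q' + J mod q')"
proof -
  have pos: "p > 0" "p' > 0" "q > 0" "q' > 0" "R' > 0" "C' > 0"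
    using I J by (auto intro!: gr0I)
  have digit: "K mod (a * b) div b = K div b mod a" for K a b :: nat
    by (cases "b = 0") (simp_all add: mult.commute[of a b] mod_mult2_eq)
  have mod_mod: "K mod (a * b) mod b = K mod b" for K a b :: nat
    by (simp add: mod_mod_cancel)
  \<comment> \<open>Inner blocks see \<open>I\<close> and \<open>J\<close> only modulo the outer
    block size. These equations turn the nested quotients and remainders into digits of
    \<open>I\<close> and \<open>J\<close> themselves.\<close>
  note idx = digit[of _ R' "p * p'"] digit[of _ C' "q * q'"] mod_mod
    mod_mod[of _ "R' * p" p', unfolded mult.assoc] mod_mod[of _ "C' * q" q', unfolded mult.assoc]
  have lt: "I mod (p * p') div p' < p" "J mod (q * q') div q' < q"
    using pos by (simp_all add: less_mult_imp_div_less)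
  show ?thesis
    using A B I J pos lt
    by (simp add: tracy_singh_def Let_def from_blocks_def[where R = R] from_blocks_def[where R = R']
        kronecker_index block_def idx)
qed

lemma direct_product_apply:
  "direct_product r s ((x, u), (y, v)) =
     ((fst (r (x, y)), fst (s (u, v))), (snd (r (x, y)), snd (s (u, v))))"
  by (simp add: direct_product_def \<sigma>_def \<gamma>_def)

text \<open>The two components do not interact, which is why an entry of the matrix of the product
  solution factors into an entry for \<open>r\<close> times an entry for \<open>s\<close>.\<close>

lemma direct_product_eq_iff:
  "direct_product r s ((x, u), (y, v)) = ((x', u'), (y', v')) \<longleftrightarrow>
     r (x, y) = (x', y') \<and> s (u, v) = (u', v')"
  by (auto simp: direct_product_apply prod_eq_iff)

lemma direct_product_closed:
  assumes "r \<in> X \<times> X \<rightarrow> X \<times> X" "s \<in> Y \<times> Y \<rightarrow> Y \<times> Y"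
  shows "direct_product r s \<in> (X \<times> Y) \<times> (X \<times> Y) \<rightarrow> (X \<times> Y) \<times> (X \<times> Y)"
proof (clarsimp simp: direct_product_apply)
  fix x u y v assume "x \<in> X" "u \<in> Y" "y \<in> X" "v \<in> Y"
  then have "r (x, y) \<in> X \<times> X" "s (u, v) \<in> Y \<times> Y" using assms by auto
  then show "fst (r (x, y)) \<in> X \<and> fst (s (u, v)) \<in> Y \<and> snd (r (x, y)) \<in> X \<and> snd (s (u, v)) \<in> Y"
    by (auto simp: mem_Times_iff)
qed

lemma involutive_direct_product:
  assumes "involutive X r" "involutive Y s"
  shows "involutive (X \<times> Y) (direct_product r s)"
  using assms by (auto simp: involutive_def direct_product_apply)

lemma is_linearisation_apply:
  assumes "is_linearisation X r b tens c" "x \<in> X" "y \<in> X"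
  shows "c (tens (b x) (b y)) = tens (b (fst (r (x, y)))) (b (snd (r (x, y))))"
  using assms by (simp add: is_linearisation_def \<sigma>_def \<gamma>_def)

text \<open>Since \<open>r\<close> is its own inverse on pairs, \<open>c\<close> composed with
  itself fixes every tensor of two basis vectors. These tensors span the space, so \<open>c\<close>
  is its own inverse.\<close>

lemma bij_linearisation:
  assumes b: "basis_indexed_by X b" and t: "tensor_product tens"
    and c: "is_linearisation X r b tens c"
    and r: "r \<in> X \<times> X \<rightarrow> X \<times> X" and inv: "involutive X r"
  shows "bij c"
proof -
  let ?B = "(\<lambda>(x, y). tens (b x) (b y)) ` (X \<times> X)"
  have sp: "span ?B = UNIV"
    using tensor_product_iff_basis[OF b b, of tens] t by (auto simp: basis_indexed_by_def)
  have lin: "linear c" using c by (simp add: is_linearisation_def)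
  have on_basis: "c (c w) = w" if w: "w \<in> ?B" for w
  proof -
    obtain x y where xy: "x \<in> X" "y \<in> X" "w = tens (b x) (b y)" using w by auto
    have "r (x, y) \<in> X \<times> X" "r (r (x, y)) = (x, y)"
      using r inv xy by (auto simp: involutive_def)
    then show ?thesis
      using is_linearisation_apply[OF c] xy by (simp add: mem_Times_iff)
  qed
  have "c (c w) = w" for w
    by (rule linear_eq_on_span[of "\<lambda>w. c (c w)" "\<lambda>w. w" ?B])
       (use lin on_basis sp linear_compose[of c c] in \<open>auto simp: o_def linear_ident\<close>)
  then show ?thesis by (intro o_bij[of c c]) auto
qed

text \<open>The tensors of basis vectors form a basis that \<open>c\<close> maps into itself, so the
  image of the \<open>q\<close>-th one has a single nonzero coordinate, at the pair \<open>r\<close>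
  assigns to the \<open>q\<close>-th pair. Columns are arguments and rows are images.\<close>

lemma representing_mat_linearisation:
  assumes b: "basis_indexed_by X b" and t: "tensor_product tens"
    and c: "is_linearisation X r b tens c"
    and r: "r \<in> X \<times> X \<rightarrow> X \<times> X" and xs: "set xs = X"
  shows "representing_mat (lex_tensor_basis b tens xs) c =
    mat (length xs * length xs) (length xs * length xs)
      (\<lambda>(p, q). if r (List.product xs xs ! q) = List.product xs xs ! p then 1 else 0)"
    (is "_ = mat ?N ?N _")
proof -
  let ?t = "\<lambda>(x, y). tens (b x) (b y)"
  have inj: "inj_on ?t (X \<times> X)" and ind: "independent (?t ` (X \<times> X))"
    using tensor_product_iff_basis[OF b b, of tens] t by (auto simp: basis_indexed_by_def)
  have in_X: "List.product xs xs ! q \<in> X \<times> X" if "q < ?N" for q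
    using that nth_mem[of q "List.product xs xs"] xs by simp
  have "representation (?t ` (X \<times> X)) (c (?t w)) (?t v) = (if r w = v then 1 else 0)"
    if "w \<in> X \<times> X" "v \<in> X \<times> X" for w v
  proof -
    have rw: "r w \<in> X \<times> X" using r that by blast
    have "c (?t w) = ?t (r w)"
      using is_linearisation_apply[OF c] that by (auto simp: case_prod_beta)
    \<comment> \<open>Injectivity of the indexing turns equality of basis vectors into equality of
      pairs.\<close>
    moreover have "?t v = ?t (r w) \<longleftrightarrow> v = r w"
      using inj_on_eq_iff[OF inj that(2) rw] .
    ultimately show ?thesis
      using representation_basis[OF ind, of "?t (r w)"] rw by auto
  qed
  then show ?thesis
    unfolding representing_mat_def lex_tensor_basis_def
    by (intro eq_matI) (auto simp: xs in_X simp del: product_nth)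
qed

theorem theorem1:
  fixes X :: "'a set" and r :: "'a \<times> 'a \<Rightarrow> 'a \<times> 'a" and xs :: "'a list" and n :: nat
    and Y :: "'b set" and s :: "'b \<times> 'b \<Rightarrow> 'b \<times> 'b" and ys :: "'b list" and m :: nat
    and bV :: "'a \<Rightarrow> 'v::real_vector" and tV :: "'v \<Rightarrow> 'v \<Rightarrow> 'vv::real_vector"
    and bV' :: "'b \<Rightarrow> 'u::real_vector" and tV' :: "'u \<Rightarrow> 'u \<Rightarrow> 'uu::real_vector"
    and bW :: "'a \<times> 'b \<Rightarrow> 'w::real_vector" and tW :: "'w \<Rightarrow> 'w \<Rightarrow> 'ww::real_vector"
    and c :: "'vv \<Rightarrow> 'vv" and d :: "'uu \<Rightarrow> 'uu" and e :: "'ww \<Rightarrow> 'ww"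
  assumes "st_YBE X r" "non_degenerate X r" "involutive X r"
    and "st_YBE Y s" "non_degenerate Y s" "involutive Y s"
    and "distinct xs" "set xs = X" "card X = n"
    and "distinct ys" "set ys = Y" "card Y = m"
    and "basis_indexed_by X bV" "tensor_product tV" "is_linearisation X r bV tV c"
    and "basis_indexed_by Y bV'" "tensor_product tV'" "is_linearisation Y s bV' tV' d"
    and "basis_indexed_by (X \<times> Y) bW" "tensor_product tW"
    and "is_linearisation (X \<times> Y) (direct_product r s) bW tW e"
  shows "linear e \<and> bij e \<and>
    representing_mat (lex_tensor_basis bW tW (List.product xs ys)) e =
      tracy_singh n n (representing_mat (lex_tensor_basis bV tV xs) c)
                  m m (representing_mat (lex_tensor_basis bV' tV' ys) d)"
proof -
  have r: "r \<in> X \<times> X \<rightarrow> X \<times> X" and s: "s \<in> Y \<times> Y \<rightarrow> Y \<times> Y"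
    using assms(1,4) by (simp_all add: st_YBE_def bij_betw_imp_funcset)
  let ?Z = "X \<times> Y" and ?t = "direct_product r s" and ?zs = "List.product xs ys"
  let ?N = "n * m"
  have t: "?t \<in> ?Z \<times> ?Z \<rightarrow> ?Z \<times> ?Z" using direct_product_closed[OF r s] .
  have len: "length xs = n" "length ys = m"
    using assms(7-12) by (auto simp: distinct_card[symmetric])
  have pos: "n > 0" "m > 0"
    using assms(1,4,8,11) len by (auto simp: st_YBE_def)
  have zs: "set ?zs = ?Z" using assms(8,11) by simp
  let ?C = "representing_mat (lex_tensor_basis bV tV xs) c"
  let ?D = "representing_mat (lex_tensor_basis bV' tV' ys) d"
  let ?E = "representing_mat (lex_tensor_basis bW tW ?zs) e"
  note C = representing_mat_linearisation[OF assms(13-15) r assms(8), unfolded len]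
  note D = representing_mat_linearisation[OF assms(16-18) s assms(11), unfolded len]
  note E = representing_mat_linearisation[OF assms(19-21) t zs, unfolded length_product len]
  have carC: "?C \<in> carrier_mat (n * n) (n * n)" and carD: "?D \<in> carrier_mat (m * m) (m * m)"
    unfolding C D by simp_all
  have "?E = tracy_singh n n ?C m m ?D"
  proof (rule eq_matI)
    note dims = tracy_singh_dim[OF carC carD pos(1,1) pos(2,2)]
    show "dim_row ?E = dim_row (tracy_singh n n ?C m m ?D)"
      "dim_col ?E = dim_col (tracy_singh n n ?C m m ?D)"
      unfolding dims E by simp_all
    fix I J
    assume "I < dim_row (tracy_singh n n ?C m m ?D)" "J < dim_col (tracy_singh n n ?C m m ?D)"
    then have IJ: "I < n * (m * (n * m))" "J < n * (m * (n * m))" unfolding dims .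
    \<comment> \<open>The digits are functions of the index, so that the facts below serve both the
      row \<open>I\<close> and the column \<open>J\<close>:
      \<open>K = ((i K * m + k K) * n + a K) * m + b K\<close>.\<close>
    define i k a b where digits:
      "i = (\<lambda>I. I div (m * ?N))" "k = (\<lambda>I. I div ?N mod m)"
      "a = (\<lambda>I. I mod ?N div m)" "b = (\<lambda>I::nat. I mod m)"
    have bounds: "i K < n" "k K < m" "a K < n" "b K < m" if "K < n * (m * ?N)" for K
      using that pos unfolding digits by (simp_all add: less_mult_imp_div_less)
    \<comment> \<open>Division by \<open>?N\<close> separates the two elements of \<open>?Z\<close>;
      dividing each part by \<open>m\<close> separates its components.\<close>
    have nthZ: "List.product ?zs ?zs ! K = ((xs ! i K, ys ! k K), (xs ! a K, ys ! b K))"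
      if K: "K < n * (m * ?N)" for K
    proof -
      have "K < ?N * ?N" using K by (simp add: mult.assoc)
      moreover have "K div ?N < ?N" using calculation by (simp add: less_mult_imp_div_less)
      moreover have "K div ?N div m = K div (m * ?N)"
        by (simp add: div_mult2_eq[symmetric] mult.commute)
      moreover have "K mod ?N mod m = K mod m" by (simp add: mod_mod_cancel)
      ultimately show ?thesis using pos len by (simp add: product_nth digits)
    qed
    have nthX: "List.product xs xs ! (i K * n + a K) = (xs ! i K, xs ! a K)"
      and nthY: "List.product ys ys ! (k K * m + b K) = (ys ! k K, ys ! b K)"
      and lt: "i K * n + a K < n * n" "k K * m + b K < m * m"
      if K: "K < n * (m * ?N)" for K
      using bounds[OF K] len by (simp_all add: product_nth nat_mult_add_less)
    have "tracy_singh n n ?C m m ?D $$ (I, J) =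
        ?C $$ (i I * n + a I, i J * n + a J) * ?D $$ (k I * m + b I, k J * m + b J)"
      unfolding tracy_singh_index[OF carC carD IJ] digits ..
    \<comment> \<open>A product of two 0/1 indicators is the indicator of the conjunction.\<close>
    also have "\<dots> = (if r (xs ! i J, xs ! a J) = (xs ! i I, xs ! a I) \<and>
        s (ys ! k J, ys ! b J) = (ys ! k I, ys ! b I) then 1 else 0)"
      unfolding C D using lt nthX nthY IJ by simp
    also have "\<dots> = ?E $$ (I, J)"
      unfolding E using IJ by (simp add: nthZ direct_product_eq_iff mult.assoc)
    finally show "?E $$ (I, J) = tracy_singh n n ?C m m ?D $$ (I, J)" by simp
  qed
  moreover have "bij e"
    using bij_linearisation[OF assms(19-21) t involutive_direct_product[OF assms(3,6)]] .
  moreover have "linear e" using assms(21) by (simp add: is_linearisation_def)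
  ultimately show ?thesis by blast
qed

end
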